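(* Let $f$ be a nonnegative operator monotone function on $(0,\infty)$, let $q\in\mathbb R$, and let $\mathbf A=(A_s)_{s\in T}$ and $\mathbf B=(B_s)_{s\in T}$ be continuous fields of strictly positive operators in $\mathscr A$. Then the generalized relative operator entropy is homogeneous; i.e. for any $0\neq\alpha\in\mathbb R$, $$\widetilde S_q^f(\alpha\mathbf A|\alpha\mathbf B)=\alpha\,\widetilde S_q^f(\mathbf A|\mathbf B),$$ where $\alpha\mathbf A=(\alpha A_s)_{s\in T}$ and likewise $\alpha\mathbf B=(\alpha B_s)_{s\in T}$.
   Context: $\mathscr H$ is a complex Hilbert space. An operator in $\mathbb B(\mathscr H)$ is strictly positive if it is positive and invertible. $\mathscr A$ is a $C^*$-algebra of operators acting on $\mathscr H$, $T$ is a locally compact Hausdorff space and $\mu$ is a Radon measure on $T$. A family $(A_t)_{t\in T}$ in $\mathscr A$ is a continuous field of operators if $t\mapsto A_t$ is norm continuous and $t\mapsto\|A_t\|$ is $\mu$-integrable; its Bochner integral $\int_T A_t\,d\mu(t)$ is the unique element of $\mathscr A$ with $\varphi(\int_T A_t\,d\mu(t))=\int_T\varphi(A_t)\,d\mu(t)$ for all $\varphi$ in the norm dual $\mathscr A^*$. A continuous function $f:J\to\mathbb R$ on an interval $J$ is operator monotone if $X\le Y$ implies $f(X)\le f(Y)$ for all self-adjoint operators $X,Y\in\mathbb B(\mathscr H)$ with spectra in $J$. For strictly positive $X,Y$ and $q\in\mathbb R$, $S_q^f(X|Y)=X^{1/2}(X^{-1/2}YX^{-1/2})^q f(X^{-1/2}YX^{-1/2})X^{1/2}$.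 The generalized relative operator entropy is $\widetilde S_q^f(\mathbf A|\mathbf B)=\int_T S_q^f(A_s|B_s)\,d\mu(s)$ (Bochner integral). *)

theory Defs
  imports "HOL-Analysis.Analysis" "HOL-Computational_Algebra.Polynomial"
begin

section \<open>Complex Hilbert spaces\<close>

text \<open>The inner product is conjugate-linear in its first argument.  The last axiom makes the
  inner product positive definite and the Banach norm the one it induces.\<close>

class chilbert_space = banach +
  fixes scaleC :: "complex \<Rightarrow> 'a \<Rightarrow> 'a" (infixr \<open>*\<^sub>C\<close> 75)
    and cinner :: "'a \<Rightarrow> 'a \<Rightarrow> complex"
  assumes scaleC_add_right: "a *\<^sub>C (x + y) = a *\<^sub>C x + a *\<^sub>C y"
    and scaleC_add_left: "(a + b) *\<^sub>C x = a *\<^sub>C x + b *\<^sub>C x"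
    and scaleC_scaleC: "a *\<^sub>C b *\<^sub>C x = (a * b) *\<^sub>C x"
    and scaleR_scaleC: "r *\<^sub>R x = complex_of_real r *\<^sub>C x"
    and cinner_commute: "cinner x y = cnj (cinner y x)"
    and cinner_add_right: "cinner x (y + z) = cinner x y + cinner x z"
    and cinner_scaleC_right: "cinner x (a *\<^sub>C y) = a * cinner x y"
    and cinner_self: "cinner x x = complex_of_real ((norm x)\<^sup>2)"

instantiation complex :: chilbert_space
begin

definition "scaleC_complex (a :: complex) (x :: complex) = a * x"
definition "cinner_complex (x :: complex) (y :: complex) = cnj x * y"

instance
  by standard
    (auto simp: scaleC_complex_def cinner_complex_def algebra_simps scaleR_conv_of_real
      simp flip: complex_norm_square)

end

lemma norm_scaleC: "norm (a *\<^sub>C x) = cmod a * norm (x :: 'a :: chilbert_space)"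
proof -
  have "cinner (a *\<^sub>C x) (a *\<^sub>C x) = a * cnj (a * cinner x x)"
    by (subst cinner_scaleC_right, subst cinner_commute, subst cinner_scaleC_right) (rule refl)
  also have "\<dots> = (a * cnj a) * cinner x x"
    by (simp add: cinner_self)
  also have "\<dots> = complex_of_real ((cmod a * norm x)\<^sup>2)"
    by (simp add: cinner_self power_mult_distrib flip: complex_norm_square)
  finally have "complex_of_real ((norm (a *\<^sub>C x))\<^sup>2) = complex_of_real ((cmod a * norm x)\<^sup>2)"
    by (simp only: cinner_self)
  then have "(norm (a *\<^sub>C x))\<^sup>2 = (cmod a * norm x)\<^sup>2"
    by (simp only: of_real_eq_iff)
  then show ?thesis
    by (simp add: power2_eq_iff_nonneg)
qed

section \<open>Bounded operators\<close>

text \<open>An element of \<open>'h \<Rightarrow>\<^sub>L 'h\<close> is only real linear; the bounded operators on the complex Hilbert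
  space \<open>'h\<close> are the elements of \<open>clinear_ops\<close>.\<close>

definition clinear_ops :: "('h::chilbert_space \<Rightarrow>\<^sub>L 'h) set"
  where "clinear_ops = {X :: 'h \<Rightarrow>\<^sub>L 'h. \<forall>c x. X (c *\<^sub>C x) = c *\<^sub>C X x}"

lift_definition scalar_op :: "complex \<Rightarrow> ('h::chilbert_space \<Rightarrow>\<^sub>L 'h)" is "\<lambda>c x. c *\<^sub>C x"
proof -
  fix c :: complex
  show "bounded_linear (\<lambda>x :: 'h. c *\<^sub>C x)"
    by (rule bounded_linear_intro[where K = "cmod c"])
      (simp_all add: scaleC_add_right scaleR_scaleC scaleC_scaleC norm_scaleC mult.commute)
qed

definition is_adjoint :: "('h::chilbert_space \<Rightarrow>\<^sub>L 'h) \<Rightarrow> ('h \<Rightarrow>\<^sub>L 'h) \<Rightarrow> bool"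
  where "is_adjoint X Y \<longleftrightarrow> (\<forall>x y. cinner (X x) y = cinner x (Y y))"

definition self_adjoint :: "('h::chilbert_space \<Rightarrow>\<^sub>L 'h) \<Rightarrow> bool"
  where "self_adjoint X \<longleftrightarrow> X \<in> clinear_ops \<and> is_adjoint X X"

definition positive_op :: "('h::chilbert_space \<Rightarrow>\<^sub>L 'h) \<Rightarrow> bool"
  where "positive_op X \<longleftrightarrow> X \<in> clinear_ops \<and> (\<forall>x. cinner x (X x) \<in> \<real>\<^sub>\<ge>\<^sub>0)"

definition invertible_op :: "('h::chilbert_space \<Rightarrow>\<^sub>L 'h) \<Rightarrow> bool"
  where "invertible_op X \<longleftrightarrow>
    (\<exists>Y\<in>clinear_ops. X o\<^sub>L Y = id_blinfun \<and> Y o\<^sub>L X = id_blinfun)"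

definition strictly_positive :: "('h::chilbert_space \<Rightarrow>\<^sub>L 'h) \<Rightarrow> bool"
  where "strictly_positive X \<longleftrightarrow> positive_op X \<and> invertible_op X"

definition spectrum :: "('h::chilbert_space \<Rightarrow>\<^sub>L 'h) \<Rightarrow> complex set"
  where "spectrum X = {c. \<not> invertible_op (X - scalar_op c)}"

definition cstar_algebra :: "('h::chilbert_space \<Rightarrow>\<^sub>L 'h) set \<Rightarrow> bool"
  where "cstar_algebra \<A> \<longleftrightarrow>
    \<A> \<subseteq> clinear_ops \<and> 0 \<in> \<A> \<and>
    (\<forall>X\<in>\<A>. \<forall>Y\<in>\<A>. X + Y \<in> \<A>) \<and>
    (\<forall>c. \<forall>X\<in>\<A>. scalar_op c o\<^sub>L X \<in> \<A>) \<and>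
    (\<forall>X\<in>\<A>. \<forall>Y\<in>\<A>. X o\<^sub>L Y \<in> \<A>) \<and>
    (\<forall>X\<in>\<A>. \<exists>Y\<in>\<A>. is_adjoint X Y) \<and>
    closed \<A>"

section \<open>Continuous functional calculus\<close>

definition poly_op :: "complex poly \<Rightarrow> ('h::chilbert_space \<Rightarrow>\<^sub>L 'h) \<Rightarrow> ('h \<Rightarrow>\<^sub>L 'h)"
  where "poly_op p X =
    (\<Sum>i\<le>degree p. scalar_op (coeff p i) o\<^sub>L (((o\<^sub>L) X ^^ i) id_blinfun))"

text \<open>For a self-adjoint operator \<open>X\<close> and a function \<open>g\<close> that is continuous on the (real) spectrum of
  \<open>X\<close>, \<open>cfc g X\<close> is \<open>g(X)\<close>: the norm limit of the operators \<open>p\<^sub>n(X)\<close>, for polynomials \<open>p\<^sub>n\<close> that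
  converge to \<open>g\<close> uniformly on the spectrum.  It is only meant for such \<open>X\<close> and \<open>g\<close>.\<close>

definition has_cfc :: "(complex \<Rightarrow> complex) \<Rightarrow> ('h::chilbert_space \<Rightarrow>\<^sub>L 'h) \<Rightarrow> ('h \<Rightarrow>\<^sub>L 'h) \<Rightarrow> bool"
  where "has_cfc g X Z \<longleftrightarrow>
    (\<exists>p :: nat \<Rightarrow> complex poly.
      uniform_limit (spectrum X) (\<lambda>n. poly (p n)) g sequentially \<and>
      (\<lambda>n. poly_op (p n) X) \<longlonglongrightarrow> Z)"

definition cfc :: "(complex \<Rightarrow> complex) \<Rightarrow> ('h::chilbert_space \<Rightarrow>\<^sub>L 'h) \<Rightarrow> ('h \<Rightarrow>\<^sub>L 'h)"
  where "cfc g X = (THE Z. has_cfc g X Z)"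

definition real_cfc :: "(real \<Rightarrow> real) \<Rightarrow> ('h::chilbert_space \<Rightarrow>\<^sub>L 'h) \<Rightarrow> ('h \<Rightarrow>\<^sub>L 'h)"
  where "real_cfc f = cfc (\<lambda>z. complex_of_real (f (Re z)))"

text \<open>Real powers use the principal branch, which is continuous on the nonzero reals.  On strictly
  positive operators they are the usual powers, and they are also defined on all other invertible
  self-adjoint operators, such as the negative multiples of a strictly positive one.\<close>

definition op_power :: "('h::chilbert_space \<Rightarrow>\<^sub>L 'h) \<Rightarrow> real \<Rightarrow> ('h \<Rightarrow>\<^sub>L 'h)"
  where "op_power X r = cfc (\<lambda>z. z powr complex_of_real r) X"

definition operator_monotone_on :: "'h::chilbert_space itself \<Rightarrow> real set \<Rightarrow> (real \<Rightarrow> real) \<Rightarrow> bool"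
  where "operator_monotone_on _ J f \<longleftrightarrow>
    continuous_on J f \<and>
    (\<forall>X Y :: 'h \<Rightarrow>\<^sub>L 'h. self_adjoint X \<longrightarrow> self_adjoint Y \<longrightarrow>
      spectrum X \<subseteq> complex_of_real ` J \<longrightarrow> spectrum Y \<subseteq> complex_of_real ` J \<longrightarrow>
      positive_op (Y - X) \<longrightarrow> positive_op (real_cfc f Y - real_cfc f X))"

section \<open>Fields of operators and their integrals\<close>

definition radon_measure :: "'t::t2_space measure \<Rightarrow> bool"
  where "radon_measure \<mu> \<longleftrightarrow>
    sets \<mu> = sets borel \<and>
    (\<forall>K. compact K \<longrightarrow> emeasure \<mu> K < \<infinity>) \<and>
    (\<forall>E\<in>sets borel. emeasure \<mu> E = (INF U\<in>{U. open U \<and> E \<subseteq> U}. emeasure \<mu> U)) \<and>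
    (\<forall>U. open U \<longrightarrow> emeasure \<mu> U = (SUP K\<in>{K. compact K \<and> K \<subseteq> U}. emeasure \<mu> K))"

definition continuous_field ::
    "('h::chilbert_space \<Rightarrow>\<^sub>L 'h) set \<Rightarrow> 't::t2_space measure \<Rightarrow> ('t \<Rightarrow> 'h \<Rightarrow>\<^sub>L 'h) \<Rightarrow> bool"
  where "continuous_field \<A> \<mu> A \<longleftrightarrow>
    range A \<subseteq> \<A> \<and> continuous_on UNIV A \<and> integrable \<mu> (\<lambda>t. norm (A t))"

text \<open>The norm dual of \<open>\<A>\<close>; the values of a functional outside \<open>\<A>\<close> play no role.\<close>

definition norm_dual ::
    "('h::chilbert_space \<Rightarrow>\<^sub>L 'h) set \<Rightarrow> (('h \<Rightarrow>\<^sub>L 'h) \<Rightarrow> complex) set"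
  where "norm_dual \<A> = {\<phi>.
    (\<forall>X\<in>\<A>. \<forall>Y\<in>\<A>. \<phi> (X + Y) = \<phi> X + \<phi> Y) \<and>
    (\<forall>c. \<forall>X\<in>\<A>. \<phi> (scalar_op c o\<^sub>L X) = c * \<phi> X) \<and>
    (\<exists>K. \<forall>X\<in>\<A>. cmod (\<phi> X) \<le> K * norm X)}"

text \<open>The library's Bochner integral needs a second countable codomain, which the space of operators
  is not in general.\<close>

definition has_field_integral ::
    "('h::chilbert_space \<Rightarrow>\<^sub>L 'h) set \<Rightarrow> 't::t2_space measure \<Rightarrow> ('t \<Rightarrow> 'h \<Rightarrow>\<^sub>L 'h) \<Rightarrow> ('h \<Rightarrow>\<^sub>L 'h) \<Rightarrow> bool"
  where "has_field_integral \<A> \<mu> A I \<longleftrightarrow>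
    continuous_field \<A> \<mu> A \<and> I \<in> \<A> \<and> (\<forall>\<phi>\<in>norm_dual \<A>. \<phi> I = (LINT t|\<mu>. \<phi> (A t)))"

text \<open>As for the library's integrals, the value is 0 if the integral does not exist.\<close>

definition field_integral ::
    "('h::chilbert_space \<Rightarrow>\<^sub>L 'h) set \<Rightarrow> 't::t2_space measure \<Rightarrow> ('t \<Rightarrow> 'h \<Rightarrow>\<^sub>L 'h) \<Rightarrow> ('h \<Rightarrow>\<^sub>L 'h)"
  where "field_integral \<A> \<mu> A =
    (if \<exists>I. has_field_integral \<A> \<mu> A I then THE I. has_field_integral \<A> \<mu> A I else 0)"

section \<open>Generalized relative operator entropy\<close>

definition rel_entropy ::
    "(real \<Rightarrow> real) \<Rightarrow> real \<Rightarrow> ('h::chilbert_space \<Rightarrow>\<^sub>L 'h) \<Rightarrow> ('h \<Rightarrow>\<^sub>L 'h) \<Rightarrow> ('h \<Rightarrow>\<^sub>L 'h)"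
  where "rel_entropy f q X Y =
    (let M = op_power X (-1/2) o\<^sub>L Y o\<^sub>L op_power X (-1/2)
     in op_power X (1/2) o\<^sub>L op_power M q o\<^sub>L real_cfc f M o\<^sub>L op_power X (1/2))"

definition gen_rel_entropy ::
    "('h::chilbert_space \<Rightarrow>\<^sub>L 'h) set \<Rightarrow> 't::t2_space measure \<Rightarrow> (real \<Rightarrow> real) \<Rightarrow> real \<Rightarrow>
     ('t \<Rightarrow> 'h \<Rightarrow>\<^sub>L 'h) \<Rightarrow> ('t \<Rightarrow> 'h \<Rightarrow>\<^sub>L 'h) \<Rightarrow> ('h \<Rightarrow>\<^sub>L 'h)"
  where "gen_rel_entropy \<A> \<mu> f q A B = field_integral \<A> \<mu> (\<lambda>s. rel_entropy f q (A s) (B s))"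

end

theory Submission
  imports Defs "HOL-Computational_Algebra.Fundamental_Theorem_Algebra"
begin

text \<open>The functional calculus is equivariant under real scalars \<open>a \<noteq> 0\<close>: substituting \<open>z / a\<close> in the
  approximating polynomials gives \<open>(a X)\<^sup>r = a\<^sup>r X\<^sup>r\<close> for strictly positive \<open>X\<close>, where \<open>a\<^sup>r\<close> is the
  principal power and thus a complex number if \<open>a < 0\<close> (lemma \<open>op_power_scaleR\<close>).  Write \<open>M\<close> for
  \<open>X\<^bsup>-1/2\<^esup> Y X\<^bsup>-1/2\<^esup>\<close>.  In the corresponding operator for \<open>a X\<close> and \<open>a Y\<close> the scalars multiply to
  \<open>a\<^bsup>-1/2\<^esup> a a\<^bsup>-1/2\<^esup> = 1\<close>, so it is \<open>M\<close> again, and the two outer factors \<open>(a X)\<^bsup>1/2\<^esup>\<close> contribute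
  \<open>a\<^bsup>1/2\<^esup> a\<^bsup>1/2\<^esup> = a\<close>.  Hence the integrand is homogeneous (lemma \<open>rel_entropy_scaleR\<close>), and
  integration commutes with scalars.

  For negative \<open>a\<close> the factor \<open>a\<^bsup>1/2\<^esup>\<close> is imaginary and can be pulled out only past complex linear
  operators.  Operators in general are merely real linear here, so \<open>M\<^sup>q\<close> and \<open>f(M)\<close> must be shown to
  be genuine limits of polynomials of \<open>M\<close>.  They are, because \<open>f\<close> and the power are continuous on
  \<open>(0, \<infinity>)\<close> and \<open>M\<close> is strictly positive, which in turn holds because \<open>X\<^bsup>-1/2\<^esup>\<close> is self-adjoint
  and invertible.

  Most of the text therefore constructs the functional calculus, that is, proves that the limit in
  \<open>has_cfc\<close> exists and is unique.  Both follow from the Weierstrass theorem and the estimate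
  \<open>\<parallel>p(X)\<parallel> \<le> sup \<bar>p\<bar>\<close> over the spectrum of a self-adjoint \<open>X\<close> (lemma \<open>norm_poly_op_le\<close>).  The estimate
  combines three elementary facts: a normal operator that is bounded below is invertible, the norm
  of a self-adjoint operator on a nontrivial space is attained on its spectrum, and every spectral
  value of \<open>p(X)\<close> is the value of \<open>p\<close> at a spectral value of \<open>X\<close>.\<close>

section \<open>The inner product\<close>

lemma scaleC_minus_one: "(-1) *\<^sub>C x = - (x :: 'h::chilbert_space)"
  using scaleR_scaleC[of "-1" x] by simp

lemma scaleC_one [simp]: "1 *\<^sub>C x = (x :: 'h::chilbert_space)"
  using scaleR_scaleC[of 1 x] by simp

lemma scaleC_minus_right: "a *\<^sub>C (- x) = - (a *\<^sub>C (x :: 'h::chilbert_space))"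
  using scaleC_scaleC[of a "-1" x] scaleC_scaleC[of "-1" a x] by (simp add: scaleC_minus_one)

lemma scaleC_diff_right: "a *\<^sub>C (x - y) = a *\<^sub>C x - a *\<^sub>C (y :: 'h::chilbert_space)"
  using scaleC_add_right[of a x "- y"] by (simp add: scaleC_minus_right)

lemma cinner_scaleC_left: "cinner (a *\<^sub>C x) y = cnj a * cinner x (y :: 'h::chilbert_space)"
  by (subst (1 2) cinner_commute) (simp add: cinner_scaleC_right)

lemma cinner_add_left: "cinner (x + y) z = cinner x z + cinner y (z :: 'h::chilbert_space)"
  by (subst (1 2 3) cinner_commute) (simp add: cinner_add_right)

lemma cinner_minus_right: "cinner x (- y) = - cinner x (y :: 'h::chilbert_space)"
  using cinner_scaleC_right[of x "-1" y] by (simp add: scaleC_minus_one)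

lemma cinner_minus_left: "cinner (- x) y = - cinner x (y :: 'h::chilbert_space)"
  using cinner_scaleC_left[of "-1" x y] by (simp add: scaleC_minus_one)

lemma cinner_diff_right: "cinner x (y - z) = cinner x y - cinner x (z :: 'h::chilbert_space)"
  using cinner_add_right[of x y "- z"] by (simp add: cinner_minus_right)

lemma cinner_diff_left: "cinner (x - y) z = cinner x z - cinner y (z :: 'h::chilbert_space)"
  using cinner_add_left[of x "- y" z] by (simp add: cinner_minus_left)

lemma cinner_zero_left [simp]: "cinner 0 y = 0" and cinner_zero_right [simp]: "cinner y 0 = 0"
  for y :: "'h::chilbert_space"
  using cinner_diff_left[of y y y] cinner_diff_right[of y y y] by simp_all

lemma norm_diff_squared:
  "(norm (x - y))\<^sup>2 = (norm x)\<^sup>2 - 2 * Re (cinner x y) + (norm y)\<^sup>2" for x y :: "'h::chilbert_space"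
proof -
  have "Re (cinner y x) = Re (cinner x y)"
    by (subst cinner_commute) simp
  moreover have "(norm z)\<^sup>2 = Re (cinner z z)" for z :: 'h
    by (simp only: cinner_self Re_complex_of_real)
  ultimately show ?thesis
    by (simp add: cinner_diff_left cinner_diff_right)
qed

lemma Cauchy_Schwarz_cinner: "cmod (cinner x y) \<le> norm x * norm y" for x y :: "'h::chilbert_space"
proof (cases "x = 0")
  case False
  let ?c = "cinner x y"
  \<comment> \<open>\<open>?u - ?v\<close> is \<open>(norm x)\<^sup>2\<close> times the component of \<open>y\<close> orthogonal to \<open>x\<close>\<close>
  let ?u = "complex_of_real ((norm x)\<^sup>2) *\<^sub>C y" and ?v = "?c *\<^sub>C x"
  have "cinner ?u ?v = complex_of_real ((norm x)\<^sup>2 * (cmod ?c)\<^sup>2)"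
    using complex_norm_square[of ?c]
    by (simp add: cinner_scaleC_left cinner_scaleC_right cinner_commute[of y x] mult_ac)
  then have "Re (cinner ?u ?v) = (norm x)\<^sup>2 * (cmod ?c)\<^sup>2"
    by (metis Re_complex_of_real)
  then have "(norm (?u - ?v))\<^sup>2 = (norm x)\<^sup>2 * ((norm x * norm y)\<^sup>2 - (cmod ?c)\<^sup>2)"
    unfolding norm_diff_squared
    by (simp add: norm_scaleC norm_mult norm_power power2_eq_square algebra_simps)
  then have "0 \<le> (norm x)\<^sup>2 * ((norm x * norm y)\<^sup>2 - (cmod ?c)\<^sup>2)"
    by (metis zero_le_power2)
  then have "(cmod ?c)\<^sup>2 \<le> (norm x * norm y)\<^sup>2"
    using False by (simp add: zero_le_mult_iff)
  then show ?thesis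
    by (rule power2_le_imp_le) simp
qed simp

lemma cinner_eqI:
  assumes "\<And>y. cinner y a = cinner y (b :: 'h::chilbert_space)"
  shows "a = b"
proof -
  have "cinner (a - b) (a - b) = 0"
    using assms by (simp add: cinner_diff_right)
  then show ?thesis
    by (simp add: cinner_self)
qed

lemma bounded_linear_cinner_right: "bounded_linear (cinner (x :: 'h::chilbert_space))"
proof (rule bounded_linear_intro)
  show "norm (cinner x y) \<le> norm y * norm x" for y
    using Cauchy_Schwarz_cinner[of x y] by (simp add: mult.commute)
qed (simp_all add: cinner_add_right cinner_scaleC_right scaleR_scaleC scaleC_complex_def)

lemma bounded_linear_scaleC_right: "bounded_linear (\<lambda>x :: 'h::chilbert_space. c *\<^sub>C x)"
  using blinfun.bounded_linear_right[of "scalar_op c :: 'h \<Rightarrow>\<^sub>L 'h"] by (simp add: scalar_op.rep_eq)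

section \<open>The algebra of bounded operators\<close>

lemmas scalar_op_apply [simp] = scalar_op.rep_eq

lemma clinear_opsD: "X \<in> clinear_ops \<Longrightarrow> blinfun_apply X (c *\<^sub>C x) = c *\<^sub>C blinfun_apply X x"
  by (simp add: clinear_ops_def)

lemma scalar_op_clinear: "scalar_op c \<in> clinear_ops"
  by (simp add: clinear_ops_def scaleC_scaleC mult.commute)

lemma id_clinear: "id_blinfun \<in> clinear_ops"
  by (simp add: clinear_ops_def)

lemma compose_clinear: "X \<in> clinear_ops \<Longrightarrow> Y \<in> clinear_ops \<Longrightarrow> X o\<^sub>L Y \<in> clinear_ops"
  by (simp add: clinear_ops_def)

lemma add_clinear: "X \<in> clinear_ops \<Longrightarrow> Y \<in> clinear_ops \<Longrightarrow> X + Y \<in> clinear_ops"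
  by (simp add: clinear_ops_def blinfun.add_left scaleC_add_right)

lemma diff_clinear: "X \<in> clinear_ops \<Longrightarrow> Y \<in> clinear_ops \<Longrightarrow> X - Y \<in> clinear_ops"
  by (simp add: clinear_ops_def blinfun.diff_left scaleC_diff_right)

lemma zero_clinear: "0 \<in> clinear_ops"
  using diff_clinear[OF id_clinear id_clinear] by simp

lemmas clinear_intros =
  scalar_op_clinear id_clinear compose_clinear add_clinear diff_clinear zero_clinear

lemma scalar_op_commute:
  "X \<in> clinear_ops \<Longrightarrow> X o\<^sub>L scalar_op c = scalar_op c o\<^sub>L X"
  by (intro blinfun_eqI) (simp add: clinear_opsD)

lemma scalar_op_left_commute:
  "X \<in> clinear_ops \<Longrightarrow> X o\<^sub>L (scalar_op c o\<^sub>L Y) = scalar_op c o\<^sub>L (X o\<^sub>L Y)"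
  by (intro blinfun_eqI) (simp add: clinear_opsD)

lemma scalar_op_one: "scalar_op 1 = id_blinfun"
  by (intro blinfun_eqI) simp

lemma scalar_op_zero: "scalar_op 0 = 0"
  using scaleR_scaleC[of 0] by (intro blinfun_eqI) simp

lemma scalar_op_add: "scalar_op (a + b) = scalar_op a + scalar_op b"
  by (intro blinfun_eqI) (simp add: blinfun.add_left scaleC_add_left)

lemma scalar_op_uminus: "scalar_op (- a) = - scalar_op a"
  using scalar_op_add[of "- a" a] by (simp add: scalar_op_zero eq_neg_iff_add_eq_0)

lemma scalar_op_mult: "scalar_op (a * b) = scalar_op a o\<^sub>L scalar_op b"
  by (intro blinfun_eqI) (simp add: scaleC_scaleC)

lemma scaleR_eq_scalar_op: "r *\<^sub>R X = scalar_op (complex_of_real r) o\<^sub>L X"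
  by (intro blinfun_eqI) (simp add: blinfun.scaleR_left scaleR_scaleC)

lemma compose_id [simp]: "X o\<^sub>L id_blinfun = X" and id_compose [simp]: "id_blinfun o\<^sub>L X = X"
  by (auto intro: blinfun_eqI)

lemma blinfun_compose_assoc: "(X o\<^sub>L Y) o\<^sub>L Z = X o\<^sub>L (Y o\<^sub>L Z)"
  by (intro blinfun_eqI) simp

lemmas blinfun_compose_add_left = bounded_bilinear.add_left[OF bounded_bilinear_blinfun_compose]
lemmas blinfun_compose_add_right = bounded_bilinear.add_right[OF bounded_bilinear_blinfun_compose]
lemmas blinfun_compose_sum_right = bounded_bilinear.sum_right[OF bounded_bilinear_blinfun_compose]

lemma closed_clinear_ops: "closed (clinear_ops :: ('h::chilbert_space \<Rightarrow>\<^sub>L 'h) set)"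
proof -
  have "closed {X :: 'h \<Rightarrow>\<^sub>L 'h. X (c *\<^sub>C x) = c *\<^sub>C X x}" for c x
    by (intro closed_Collect_eq continuous_intros
      bounded_linear.continuous_on[OF bounded_linear_scaleC_right])
  then have "closed (\<Inter>c x. {X :: 'h \<Rightarrow>\<^sub>L 'h. X (c *\<^sub>C x) = c *\<^sub>C X x})"
    by (intro closed_INT ballI)
  moreover have "(clinear_ops :: ('h \<Rightarrow>\<^sub>L 'h) set) = (\<Inter>c x. {X :: 'h \<Rightarrow>\<^sub>L 'h. X (c *\<^sub>C x) = c *\<^sub>C X x})"
    by (auto simp: clinear_ops_def)
  ultimately show ?thesis
    by simp
qed

lemma is_adjointD: "is_adjoint X Y \<Longrightarrow> cinner (blinfun_apply X x) y = cinner x (blinfun_apply Y y)"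
  by (simp add: is_adjoint_def)

lemma is_adjoint_sym: "is_adjoint X Y \<Longrightarrow> is_adjoint Y X"
  unfolding is_adjoint_def by (metis cinner_commute)

lemma is_adjoint_compose:
  "is_adjoint X X' \<Longrightarrow> is_adjoint Y Y' \<Longrightarrow> is_adjoint (X o\<^sub>L Y) (Y' o\<^sub>L X')"
  by (simp add: is_adjoint_def)

lemma is_adjoint_add: "is_adjoint X X' \<Longrightarrow> is_adjoint Y Y' \<Longrightarrow> is_adjoint (X + Y) (X' + Y')"
  by (simp add: is_adjoint_def blinfun.add_left cinner_add_left cinner_add_right)

lemma is_adjoint_diff: "is_adjoint X X' \<Longrightarrow> is_adjoint Y Y' \<Longrightarrow> is_adjoint (X - Y) (X' - Y')"
  by (simp add: is_adjoint_def blinfun.diff_left cinner_diff_left cinner_diff_right)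

lemma is_adjoint_scalar_op: "is_adjoint (scalar_op c) (scalar_op (cnj c))"
  by (simp add: is_adjoint_def cinner_scaleC_left cinner_scaleC_right)

lemma is_adjoint_limit:
  assumes "\<And>n. is_adjoint (X n) (Y n)" "X \<longlonglongrightarrow> X'" "Y \<longlonglongrightarrow> Y'"
  shows "is_adjoint X' Y'"
  unfolding is_adjoint_def
proof (intro allI)
  fix x y
  have "(\<lambda>n. cnj (cinner y (X n x))) \<longlonglongrightarrow> cnj (cinner y (X' x))"
    by (intro tendsto_cnj bounded_linear.tendsto[OF bounded_linear_cinner_right]
      tendsto_intros assms)
  moreover have "(\<lambda>n. cinner x (Y n y)) \<longlonglongrightarrow> cinner x (Y' y)"
    by (intro bounded_linear.tendsto[OF bounded_linear_cinner_right] tendsto_intros assms)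
  moreover have "cnj (cinner y (X n x)) = cinner x (Y n y)" for n
    by (metis assms(1) cinner_commute is_adjointD)
  ultimately have "cnj (cinner y (X' x)) = cinner x (Y' y)"
    using LIMSEQ_unique by auto
  then show "cinner (X' x) y = cinner x (Y' y)"
    by (metis cinner_commute)
qed

text \<open>The cross terms of \<open>\<langle>x + y, X (x + y)\<rangle>\<close> and of \<open>\<langle>x + \<i> y, X (x + \<i> y)\<rangle>\<close> give the imaginary
  and the real part of the symmetry.\<close>

lemma positive_op_imp_self_adjoint:
  assumes "positive_op X"
  shows "self_adjoint X"
proof -
  have lin: "X \<in> clinear_ops" and pos: "cinner x (X x) \<in> \<real>\<^sub>\<ge>\<^sub>0" for x
    using assms by (auto simp: positive_op_def)
  have im: "Im (cinner x (X x)) = 0" for x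
    using pos[of x] by (auto elim: nonneg_Reals_cases)
  have "cinner (X x) y = cinner x (X y)" for x y
  proof -
    have "Im (cinner x (X y)) + Im (cinner y (X x)) = 0"
      using im[of "x + y"] by (simp add: blinfun.add_right cinner_add_left cinner_add_right im)
    moreover have "Re (cinner x (X y)) - Re (cinner y (X x)) = 0"
      using im[of "x + \<i> *\<^sub>C y"] by (simp add: blinfun.add_right cinner_add_left cinner_add_right
        cinner_scaleC_left cinner_scaleC_right clinear_opsD[OF lin] im)
    ultimately have "cinner x (X y) = cnj (cinner y (X x))"
      by (simp add: complex_eq_iff)
    then show ?thesis
      by (metis cinner_commute)
  qed
  then show ?thesis
    using lin by (simp add: self_adjoint_def is_adjoint_def)
qed

section \<open>Polynomials of an operator\<close>

lemma poly_op_0 [simp]: "poly_op 0 X = 0"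
  by (simp add: poly_op_def scalar_op_zero)

lemma poly_op_pCons:
  assumes "X \<in> clinear_ops"
  shows "poly_op (pCons a p) X = scalar_op a + (X o\<^sub>L poly_op p X)"
proof (cases "p = 0")
  case False
  then show ?thesis
    unfolding poly_op_def
    by (simp add: sum.atMost_Suc_shift scalar_op_left_commute[OF assms] blinfun_compose_sum_right
      del: sum.atMost_Suc)
qed (simp add: poly_op_def scalar_op_zero)

lemma poly_op_clinear: "X \<in> clinear_ops \<Longrightarrow> poly_op p X \<in> clinear_ops"
  by (induction p) (auto simp: poly_op_pCons intro!: clinear_intros)

lemma poly_op_const: "X \<in> clinear_ops \<Longrightarrow> poly_op [:c:] X = scalar_op c"
  by (simp add: poly_op_pCons)

lemma poly_op_add:
  "X \<in> clinear_ops \<Longrightarrow> poly_op (p + q) X = poly_op p X + poly_op q X"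
proof (induction p q rule: poly_induct2)
  case (pCons a p b q)
  then show ?case
    by (simp add: poly_op_pCons scalar_op_add blinfun_compose_add_right)
qed simp

lemma poly_op_smult:
  "X \<in> clinear_ops \<Longrightarrow> poly_op (smult c p) X = scalar_op c o\<^sub>L poly_op p X"
proof (induction p)
  case (pCons a p)
  then show ?case
    by (simp add: poly_op_pCons scalar_op_mult scalar_op_left_commute blinfun_compose_add_right)
qed simp

lemma poly_op_diff:
  assumes "X \<in> clinear_ops"
  shows "poly_op (p - q) X = poly_op p X - poly_op q X"
  using poly_op_add[OF assms, of "p - q" q] by simp

lemma poly_op_mult:
  "X \<in> clinear_ops \<Longrightarrow> poly_op (p * q) X = poly_op p X o\<^sub>L poly_op q X"
proof (induction p)
  case (pCons a p)
  then show ?case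
    by (simp add: mult_pCons_left poly_op_add poly_op_smult poly_op_pCons scalar_op_zero
      blinfun_compose_add_left blinfun_compose_assoc)
qed simp

lemma poly_op_pcompose:
  "X \<in> clinear_ops \<Longrightarrow> poly_op (pcompose p q) X = poly_op p (poly_op q X)"
proof (induction p)
  case (pCons a p)
  then show ?case
    by (simp add: pcompose_pCons poly_op_add poly_op_const poly_op_mult
      poly_op_pCons[OF poly_op_clinear])
qed simp

lemma is_adjoint_poly_op:
  assumes "self_adjoint X"
  shows "is_adjoint (poly_op p X) (poly_op (map_poly cnj p) X)"
proof (induction p)
  case 0
  show ?case
    by (simp add: is_adjoint_def)
next
  case (pCons a p)
  have X: "X \<in> clinear_ops" "is_adjoint X X"
    using assms by (auto simp: self_adjoint_def)
  have "poly_op q X o\<^sub>L X = X o\<^sub>L poly_op q X" for q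
    using poly_op_mult[OF X(1), of "[:0, 1:]" q] poly_op_mult[OF X(1), of q "[:0, 1:]"]
    by (simp add: poly_op_pCons[OF X(1)] scalar_op_zero scalar_op_one mult.commute)
  then show ?case
    using is_adjoint_add[OF is_adjoint_scalar_op is_adjoint_compose[OF X(2) pCons.IH]]
    by (simp add: map_poly_pCons poly_op_pCons[OF X(1)])
qed

section \<open>Invertibility and the spectrum\<close>

text \<open>\<open>z\<close> solves \<open>X z = y\<close> if it is a fixed point of \<open>z \<mapsto> z + t X' (y - X z)\<close>, because \<open>X'\<close> is
  injective: \<open>\<parallel>X' x\<parallel> = \<parallel>X x\<parallel>\<close> by normality.  For small \<open>t > 0\<close> this map is a contraction, so that
  Banach's theorem gives surjectivity without orthogonal projections.\<close>

lemma normal_bounded_below_imp_invertible: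
  fixes X :: "'h::chilbert_space \<Rightarrow>\<^sub>L 'h"
  assumes lin: "X \<in> clinear_ops" and adj: "is_adjoint X X'" and normal: "X o\<^sub>L X' = X' o\<^sub>L X"
    and m: "m > 0" and below: "\<And>x. m * norm x \<le> norm (X x)"
  shows "invertible_op X"
proof -
  have norm_adj: "norm (X' x) = norm (X x)" for x
  proof -
    have "cinner (X' x) (X' x) = cinner x ((X o\<^sub>L X') x)"
      by (simp add: is_adjointD[OF is_adjoint_sym[OF adj]])
    also have "\<dots> = cinner (X x) (X x)"
      by (simp add: normal is_adjointD[OF adj])
    finally have "(norm (X' x))\<^sup>2 = (norm (X x))\<^sup>2"
      by (simp only: cinner_self of_real_eq_iff)
    then show ?thesis
      by (simp add: power2_eq_iff_nonneg)
  qed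
  have inj: "x = 0" if "X x = 0" for x
    using below[of x] m that by (simp add: mult_le_0_iff)
  \<comment> \<open>\<open>1 - 2 t s + t\<^sup>2 N\<^sup>2 s\<close> with \<open>t = 1 / N\<^sup>2\<close> is \<open>1 - t s\<close>; adding \<open>m\<close> to the norm makes \<open>N\<close> positive and
    \<open>t m\<^sup>2 \<le> 1\<close>.\<close>
  define N t c where "N = norm X' + m" and "t = 1 / N\<^sup>2" and "c = sqrt (1 - t * m\<^sup>2)"
  have N: "N > 0" "m \<le> N" "norm X' \<le> N"
    using m by (auto simp: N_def add_nonneg_pos)
  have t: "t > 0" "t * N\<^sup>2 = 1"
    using N by (auto simp: t_def)
  have tm: "0 < t * m\<^sup>2" "t * m\<^sup>2 \<le> 1"
    using t m N mult_left_mono[of "m\<^sup>2" "N\<^sup>2" t] by (auto simp: power_mono)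
  have contr: "norm (d - t *\<^sub>R X' (X d)) \<le> c * norm d" for d
  proof -
    have "cinner d (t *\<^sub>R X' (X d)) = complex_of_real (t * (norm (X d))\<^sup>2)"
      by (simp add: scaleR_scaleC cinner_scaleC_right cinner_self flip: is_adjointD[OF adj])
    then have "(norm (d - t *\<^sub>R X' (X d)))\<^sup>2
        = (norm d)\<^sup>2 - 2 * (t * (norm (X d))\<^sup>2) + t\<^sup>2 * (norm (X' (X d)))\<^sup>2"
      by (simp only: norm_diff_squared Re_complex_of_real) (simp add: power_mult_distrib)
    also have "norm (X' (X d)) \<le> N * norm (X d)"
      using norm_blinfun[of X' "X d"] N(3) by (meson mult_right_mono norm_ge_zero order_trans)
    then have "t\<^sup>2 * (norm (X' (X d)))\<^sup>2 \<le> t\<^sup>2 * (N * norm (X d))\<^sup>2"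
      by (intro mult_left_mono power_mono) auto
    also have "t\<^sup>2 * (N * norm (X d))\<^sup>2 = t * (t * N\<^sup>2) * (norm (X d))\<^sup>2"
      by (simp add: power2_eq_square)
    finally have "(norm (d - t *\<^sub>R X' (X d)))\<^sup>2 \<le> (norm d)\<^sup>2 - t * (norm (X d))\<^sup>2"
      by (simp add: t(2))
    moreover have "t * (m * norm d)\<^sup>2 \<le> t * (norm (X d))\<^sup>2"
      using below[of d] t m by (intro mult_left_mono power_mono) auto
    moreover have "(c * norm d)\<^sup>2 = (norm d)\<^sup>2 - t * (m * norm d)\<^sup>2"
      using tm by (simp add: c_def power_mult_distrib algebra_simps)
    ultimately have "(norm (d - t *\<^sub>R X' (X d)))\<^sup>2 \<le> (c * norm d)\<^sup>2"
      by linarith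
    then show ?thesis
      by (rule power2_le_imp_le) (use tm in \<open>simp add: c_def\<close>)
  qed
  have surj: "\<exists>z. X z = y" for y
  proof -
    define F where "F z = z + t *\<^sub>R X' (y - X z)" for z
    have diff: "F z - F w = (z - w) - t *\<^sub>R X' (X (z - w))" for z w
      by (simp add: F_def blinfun.diff_right scaleR_diff_right)
    have "\<exists>!z. F z = z"
    proof (rule banach_fix_type)
      show "\<forall>z w. dist (F z) (F w) \<le> c * dist z w"
        unfolding dist_norm diff using contr by blast
    qed (use tm in \<open>auto simp: c_def\<close>)
    then obtain z where "F z = z"
      by blast
    then have "X' (y - X z) = 0"
      using t by (simp add: F_def)
    then have "y - X z = 0"
      using norm_adj[of "y - X z"] inj[of "y - X z"] by (metis norm_eq_zero)
    then show ?thesis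
      by (intro exI[of _ z]) simp
  qed
  define Y where "Y = inv (blinfun_apply X)"
  have XY: "X (Y y) = y" for y
    unfolding Y_def using surj by (intro f_inv_into_f) (auto simp: image_iff, metis)
  have inj': "x = y" if "X x = X y" for x y
    using inj[of "x - y"] that by (simp add: blinfun.diff_right)
  have "bounded_linear Y"
  proof (rule bounded_linear_intro)
    show "norm (Y y) \<le> norm y * (1 / m)" for y
      using below[of "Y y"] m by (simp add: XY field_simps)
    show "Y (u + v) = Y u + Y v" for u v
      by (rule inj') (simp add: XY blinfun.add_right)
    show "Y (r *\<^sub>R u) = r *\<^sub>R Y u" for r u
      by (rule inj') (simp add: XY blinfun.scaleR_right)
  qed
  then have "blinfun_apply (Blinfun Y) = Y"
    by (rule bounded_linear_Blinfun_apply)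
  moreover have "Y (X x) = x" for x
    by (rule inj') (simp add: XY)
  moreover have "Y (a *\<^sub>C x) = a *\<^sub>C Y x" for a x
    by (rule inj') (simp add: XY clinear_opsD[OF lin])
  ultimately show ?thesis
    unfolding invertible_op_def
    by (intro bexI[of _ "Blinfun Y"] conjI blinfun_eqI) (auto simp: XY clinear_ops_def)
qed

lemma invertible_imp_bounded_below:
  assumes "invertible_op X"
  obtains m where "m > 0" "\<And>x. m * norm x \<le> norm (blinfun_apply X x)"
proof -
  obtain Y where Y: "Y o\<^sub>L X = id_blinfun"
    using assms by (auto simp: invertible_op_def)
  have "norm x \<le> (norm Y + 1) * norm (X x)" for x
  proof -
    have "norm x = norm (Y (X x))"
      using arg_cong[OF Y, of "\<lambda>T. T x"] by simp
    also have "\<dots> \<le> norm Y * norm (X x)"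
      by (rule norm_blinfun)
    also have "\<dots> \<le> (norm Y + 1) * norm (X x)"
      by (simp add: mult_right_mono)
    finally show ?thesis .
  qed
  moreover have "norm Y + 1 > 0"
    by (simp add: add_nonneg_pos)
  ultimately show thesis
    by (intro that[of "1 / (norm Y + 1)"]) (simp_all add: divide_le_eq mult.commute)
qed

lemma invertible_compose:
  assumes "invertible_op X" "invertible_op Y"
  shows "invertible_op (X o\<^sub>L Y)"
proof -
  obtain X' Y' where inv: "X' \<in> clinear_ops" "X o\<^sub>L X' = id_blinfun" "X' o\<^sub>L X = id_blinfun"
      "Y' \<in> clinear_ops" "Y o\<^sub>L Y' = id_blinfun" "Y' o\<^sub>L Y = id_blinfun"
    using assms by (auto simp: invertible_op_def)
  have "(X o\<^sub>L Y) o\<^sub>L (Y' o\<^sub>L X') = X o\<^sub>L (Y o\<^sub>L Y') o\<^sub>L X'"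
    and "(Y' o\<^sub>L X') o\<^sub>L (X o\<^sub>L Y) = Y' o\<^sub>L (X' o\<^sub>L X) o\<^sub>L Y"
    by (simp_all add: blinfun_compose_assoc)
  then show ?thesis
    unfolding invertible_op_def
    by (intro bexI[of _ "Y' o\<^sub>L X'"]) (use inv in \<open>auto intro: compose_clinear\<close>)
qed

lemma invertible_scalar_op:
  assumes "c \<noteq> 0"
  shows "invertible_op (scalar_op c)"
  unfolding invertible_op_def
  by (intro bexI[of _ "scalar_op (1 / c)"])
    (use assms in \<open>simp_all add: scalar_op_clinear scalar_op_one flip: scalar_op_mult\<close>)

lemma self_adjointD:
  "self_adjoint X \<Longrightarrow> X \<in> clinear_ops" "self_adjoint X \<Longrightarrow> is_adjoint X X"
  by (simp_all add: self_adjoint_def)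

lemma not_in_spectrum_if_bounded_below:
  assumes X: "self_adjoint X" and "d > 0"
    and "\<And>x. d * norm x \<le> norm ((X - scalar_op c) x)"
  shows "c \<notin> spectrum X"
proof -
  have "invertible_op (X - scalar_op c)"
  proof (rule normal_bounded_below_imp_invertible)
    show "is_adjoint (X - scalar_op c) (X - scalar_op (cnj c))"
      by (intro is_adjoint_diff is_adjoint_scalar_op self_adjointD X)
    show "(X - scalar_op c) o\<^sub>L (X - scalar_op (cnj c))
        = (X - scalar_op (cnj c)) o\<^sub>L (X - scalar_op c)"
      by (intro blinfun_eqI) (simp add: blinfun.diff_left blinfun.diff_right scaleC_diff_right
        clinear_opsD[OF self_adjointD(1)[OF X]] scaleC_scaleC mult.commute)
  qed (use assms in \<open>auto intro: clinear_intros self_adjointD\<close>)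
  then show ?thesis
    by (simp add: spectrum_def)
qed

text \<open>By the Cauchy-Schwarz inequality a lower bound on the quadratic form of \<open>X - c\<close> bounds
  \<open>X - c\<close> itself from below.\<close>

lemma not_in_spectrum_if_form_bounded_below:
  assumes X: "self_adjoint X" and d: "d > 0"
    and form: "\<And>x. d * (norm x)\<^sup>2 \<le> cmod (cinner x (X x) - c * complex_of_real ((norm x)\<^sup>2))"
  shows "c \<notin> spectrum X"
proof (rule not_in_spectrum_if_bounded_below[OF X d])
  fix x
  have "cinner x ((X - scalar_op c) x) = cinner x (X x) - c * complex_of_real ((norm x)\<^sup>2)"
    by (simp add: blinfun.diff_left cinner_diff_right cinner_scaleC_right cinner_self)
  then have "d * (norm x)\<^sup>2 \<le> norm x * norm ((X - scalar_op c) x)"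
    using form[of x] Cauchy_Schwarz_cinner[of x "(X - scalar_op c) x"] by simp
  then have "norm x * (d * norm x) \<le> norm x * norm ((X - scalar_op c) x)"
    by (simp add: power2_eq_square mult_ac)
  then show "d * norm x \<le> norm ((X - scalar_op c) x)"
    by (cases "x = 0") simp_all
qed

lemma self_adjoint_form_real:
  assumes "self_adjoint X"
  shows "Im (cinner x (X x)) = 0"
proof -
  have "cinner x (X x) = cnj (cinner x (X x))"
    by (metis assms cinner_commute is_adjointD self_adjointD(2))
  then show ?thesis
    by (metis Reals_cnj_iff complex_is_Real_iff)
qed

lemma spectrum_self_adjoint_real:
  assumes "self_adjoint X"
  shows "spectrum X \<subseteq> \<real>"
proof
  fix c assume c: "c \<in> spectrum X"
  show "c \<in> \<real>"
  proof (rule ccontr)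
    assume "c \<notin> \<real>"
    then have "c \<notin> spectrum X"
    proof (intro not_in_spectrum_if_form_bounded_below[where d = "\<bar>Im c\<bar>"] assms)
      fix x
      have "Im (cinner x (X x) - c * complex_of_real ((norm x)\<^sup>2)) = - (Im c * (norm x)\<^sup>2)"
        by (simp add: self_adjoint_form_real[OF assms])
      then have "\<bar>Im c\<bar> * (norm x)\<^sup>2 = \<bar>Im (cinner x (X x) - c * complex_of_real ((norm x)\<^sup>2))\<bar>"
        by (simp only: abs_minus_cancel abs_mult) simp
      then show "\<bar>Im c\<bar> * (norm x)\<^sup>2 \<le> cmod (cinner x (X x) - c * complex_of_real ((norm x)\<^sup>2))"
        by (simp only: abs_Im_le_cmod)
    qed (simp add: complex_is_Real_iff)
    with c show False
      by simp
  qed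
qed

lemma strictly_positive_imp_self_adjoint: "strictly_positive X \<Longrightarrow> self_adjoint X"
  by (simp add: strictly_positive_def positive_op_imp_self_adjoint)

text \<open>The lower end \<open>a\<close> is the constant by which the invertible \<open>X\<close> is bounded below and \<open>b\<close> is
  \<open>\<parallel>X\<parallel>\<close>.  Positivity of the quadratic form excludes the negative numbers.\<close>

lemma spectrum_strictly_positive:
  assumes "strictly_positive X"
  obtains a b where "a > 0" "spectrum X \<subseteq> complex_of_real ` {a..b}"
proof -
  have X: "self_adjoint X" and pos: "cinner x (X x) \<in> \<real>\<^sub>\<ge>\<^sub>0" and inv: "invertible_op X" for x
    using assms by (auto simp: strictly_positive_def positive_op_def strictly_positive_imp_self_adjoint)
  obtain m where m: "m > 0" "\<And>x. m * norm x \<le> norm (X x)"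
    using invertible_imp_bounded_below[OF inv] by blast
  have "c \<in> complex_of_real ` {m..norm X}" if c: "c \<in> spectrum X" for c
  proof -
    obtain u where u: "c = complex_of_real u"
      using c spectrum_self_adjoint_real[OF X] by (auto elim: Reals_cases)
    have diff_apply: "(X - scalar_op c) x = X x - u *\<^sub>R x" for x
      by (simp add: blinfun.diff_left u scaleR_scaleC)
    have "\<not> u < 0"
    proof
      assume "u < 0"
      then have "c \<notin> spectrum X"
      proof (intro not_in_spectrum_if_form_bounded_below[where d = "- u"] X)
        fix x
        have "- u * (norm x)\<^sup>2 \<le> Re (cinner x (X x) - c * complex_of_real ((norm x)\<^sup>2))"
          using pos[of x] by (auto simp: u elim: nonneg_Reals_cases)
        then show "- u * (norm x)\<^sup>2 \<le> cmod (cinner x (X x) - c * complex_of_real ((norm x)\<^sup>2))"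
          using complex_Re_le_cmod order_trans by blast
      qed simp
      with c show False by simp
    qed
    moreover have "\<not> (0 \<le> u \<and> u < m)"
    proof
      assume um: "0 \<le> u \<and> u < m"
      have "c \<notin> spectrum X"
      proof (rule not_in_spectrum_if_bounded_below[where d = "m - u"])
        fix x
        show "(m - u) * norm x \<le> norm ((X - scalar_op c) x)"
          using m(2)[of x] norm_triangle_ineq2[of "X x" "u *\<^sub>R x"] um
          by (simp add: diff_apply left_diff_distrib)
      qed (use X um in auto)
      with c show False by simp
    qed
    moreover have "\<not> norm X < u"
    proof
      assume uX: "norm X < u"
      then have u0: "u > 0"
        by (meson norm_ge_zero le_less_trans)
      have "c \<notin> spectrum X"
      proof (rule not_in_spectrum_if_bounded_below[where d = "u - norm X"])
        fix x
        show "(u - norm X) * norm x \<le> norm ((X - scalar_op c) x)"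
          using norm_blinfun[of X x] norm_triangle_ineq2[of "u *\<^sub>R x" "X x"] u0
          by (simp add: diff_apply left_diff_distrib norm_minus_commute)
      qed (use X uX in auto)
      with c show False by simp
    qed
    ultimately show ?thesis
      using u by auto
  qed
  then show thesis
    using that[OF m(1)] by blast
qed

text \<open>For self-adjoint \<open>T\<close> and \<open>N = \<parallel>T\<parallel>\<close>, the vectors on which \<open>T\<close> nearly attains its norm are
  almost eigenvectors of \<open>T\<^sup>2\<close> for the value \<open>N\<^sup>2\<close>:
  \<open>\<parallel>(T\<^sup>2 - N\<^sup>2) x\<parallel>\<^sup>2 = \<parallel>T\<^sup>2 x\<parallel>\<^sup>2 - 2 N\<^sup>2 \<parallel>T x\<parallel>\<^sup>2 + N\<^sup>4 \<parallel>x\<parallel>\<^sup>2 \<le> N\<^sup>4 \<parallel>x\<parallel>\<^sup>2 - N\<^sup>2 \<parallel>T x\<parallel>\<^sup>2\<close>.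
  Hence \<open>(T - N) (T + N)\<close> is not invertible.\<close>

lemma self_adjoint_norm_in_spectrum:
  fixes T :: "'h::chilbert_space \<Rightarrow>\<^sub>L 'h"
  assumes T: "self_adjoint T" and nontrivial: "(v :: 'h) \<noteq> 0"
  shows "\<exists>c\<in>spectrum T. cmod c = norm T"
proof (rule ccontr)
  assume no: "\<not> ?thesis"
  define N where "N = norm T"
  have "complex_of_real N \<notin> spectrum T" "- complex_of_real N \<notin> spectrum T"
    using no by (auto simp: N_def)
  then have "invertible_op ((T - scalar_op N) o\<^sub>L (T - scalar_op (- complex_of_real N)))"
    by (intro invertible_compose) (auto simp: spectrum_def)
  then obtain m where m: "m > 0"
    "\<And>x. m * norm x \<le> norm (((T - scalar_op N) o\<^sub>L (T - scalar_op (- complex_of_real N))) x)"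
    using invertible_imp_bounded_below by blast
  have bound: "N\<^sup>2 * (norm (T x))\<^sup>2 \<le> (N ^ 4 - m\<^sup>2) * (norm x)\<^sup>2" for x
  proof -
    have "((T - scalar_op N) o\<^sub>L (T - scalar_op (- complex_of_real N))) x = T (T x) - (N\<^sup>2) *\<^sub>R x"
      by (simp add: blinfun.diff_left blinfun.add_left blinfun.add_right scalar_op_uminus
        blinfun.minus_left power2_eq_square blinfun.scaleR_right scaleR_diff_right scaleR_add_right flip: scaleR_scaleC)
    then have "(m * norm x)\<^sup>2 \<le> (norm (T (T x) - (N\<^sup>2) *\<^sub>R x))\<^sup>2"
      using m(1) m(2)[of x] by (intro power_mono) auto
    also have "cinner (T (T x)) ((N\<^sup>2) *\<^sub>R x) = complex_of_real (N\<^sup>2 * (norm (T x))\<^sup>2)"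
      by (simp add: scaleR_scaleC cinner_scaleC_right is_adjointD[OF self_adjointD(2)[OF T]] cinner_self)
    then have "(norm (T (T x) - (N\<^sup>2) *\<^sub>R x))\<^sup>2
        = (norm (T (T x)))\<^sup>2 - 2 * (N\<^sup>2 * (norm (T x))\<^sup>2) + N ^ 4 * (norm x)\<^sup>2"
      by (simp only: norm_diff_squared Re_complex_of_real) (simp add: power_mult_distrib)
    also have "(norm (T (T x)))\<^sup>2 \<le> (N * norm (T x))\<^sup>2"
      unfolding N_def by (intro power_mono norm_blinfun) simp
    finally show ?thesis
      by (simp add: power_mult_distrib algebra_simps)
  qed
  have "0 \<le> (N ^ 4 - m\<^sup>2) * (norm v)\<^sup>2"
    using bound[of v] by (meson order_trans mult_nonneg_nonneg zero_le_power2)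
  then have mN: "m\<^sup>2 \<le> N ^ 4"
    using nontrivial by (simp add: zero_le_mult_iff)
  have N: "N > 0"
    using mN m(1) by (cases "N = 0") (auto simp: N_def)
  \<comment> \<open>The largest factor that \<open>bound\<close> permits; it is smaller than the norm.\<close>
  define b where "b = sqrt (N\<^sup>2 - m\<^sup>2 / N\<^sup>2)"
  have b2: "b\<^sup>2 = N\<^sup>2 - m\<^sup>2 / N\<^sup>2" and "b \<ge> 0"
    using mN N by (auto simp: b_def field_simps power2_eq_square power4_eq_xxxx)
  have N2b2: "N\<^sup>2 * b\<^sup>2 = N ^ 4 - m\<^sup>2"
    using N unfolding b2 right_diff_distrib by (simp add: power4_eq_xxxx power2_eq_square)
  have "N \<le> b"
    unfolding N_def
  proof (rule norm_blinfun_bound)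
    fix x
    have "N\<^sup>2 * (norm (T x))\<^sup>2 \<le> N\<^sup>2 * (b * norm x)\<^sup>2"
      using bound[of x] unfolding power_mult_distrib N2b2[symmetric] by (simp add: mult_ac)
    then have "(norm (T x))\<^sup>2 \<le> (b * norm x)\<^sup>2"
      using N by simp
    then show "norm (T x) \<le> b * norm x"
      by (rule power2_le_imp_le) (use \<open>b \<ge> 0\<close> in simp)
  qed fact
  then have "N\<^sup>2 \<le> b\<^sup>2"
    using N by (intro power_mono) auto
  then show False
    using m(1) N by (simp add: b2 divide_le_0_iff)
qed

text \<open>Over the complex numbers \<open>p\<close> splits into linear factors \<open>z - z\<^sub>i\<close>, and each \<open>X - z\<^sub>i\<close> is
  invertible.\<close>

lemma poly_op_invertible:
  assumes X: "X \<in> clinear_ops"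
  shows "p \<noteq> 0 \<Longrightarrow> (\<And>z. poly p z = 0 \<Longrightarrow> z \<notin> spectrum X) \<Longrightarrow> invertible_op (poly_op p X)"
proof (induction "degree p" arbitrary: p)
  case 0
  then obtain c where "p = [:c:]" "c \<noteq> 0"
    by (metis degree_eq_zeroE pCons_0_0)
  then show ?case
    by (simp add: poly_op_const[OF X] invertible_scalar_op)
next
  case (Suc n)
  have "\<not> constant (poly p)"
    using Suc.hyps(2) by (simp add: constant_degree)
  then obtain z where z: "poly p z = 0"
    using fundamental_theorem_of_algebra by blast
  then obtain r where r: "p = [:- z, 1:] * r"
    by (auto simp: poly_eq_0_iff_dvd)
  have r0: "r \<noteq> 0"
    using Suc.prems(1) r by auto
  have "degree p = Suc (degree r)"
    unfolding r using r0 by (subst degree_mult_eq) auto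
  then have "invertible_op (poly_op r X)"
    using Suc.hyps(2) Suc.prems(2) r r0 by (intro Suc.hyps(1)) auto
  moreover have "poly_op [:- z, 1:] X = X - scalar_op z"
    by (simp add: poly_op_pCons[OF X] scalar_op_one scalar_op_uminus)
  then have "invertible_op (poly_op [:- z, 1:] X)"
    using Suc.prems(2)[OF z] by (simp add: spectrum_def)
  ultimately show ?case
    unfolding r poly_op_mult[OF X] by (intro invertible_compose)
qed

text \<open>The spectrum is assumed to be nonempty because of the constant polynomials.\<close>

lemma spectrum_poly_op_subset:
  assumes X: "X \<in> clinear_ops" and ne: "spectrum X \<noteq> {}"
  shows "spectrum (poly_op p X) \<subseteq> poly p ` spectrum X"
proof
  fix c assume c: "c \<in> spectrum (poly_op p X)"
  show "c \<in> poly p ` spectrum X"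
  proof (rule ccontr)
    assume no: "c \<notin> poly p ` spectrum X"
    have "invertible_op (poly_op (p - [:c:]) X)"
    proof (rule poly_op_invertible[OF X])
      show "p - [:c:] \<noteq> 0"
        using no ne by auto
    qed (use no in auto)
    then show False
      using c by (simp add: spectrum_def poly_op_diff[OF X] poly_op_const[OF X])
  qed
qed

text \<open>\<open>\<parallel>p(X)\<parallel>\<^sup>2 \<le> \<parallel>p(X)\<^sup>* p(X)\<parallel>\<close>, and the norm on the right is attained on the spectrum of
  \<open>p(X)\<^sup>* p(X)\<close>, which consists of values of \<open>\<bar>p\<bar>\<^sup>2\<close> because the spectrum of \<open>X\<close> is real.  The trivial space is a separate case because there
  every spectrum is empty.\<close>

lemma norm_poly_op_le:
  fixes X :: "'h::chilbert_space \<Rightarrow>\<^sub>L 'h"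
  assumes X: "self_adjoint X" and K: "K \<ge> 0" "\<And>z. z \<in> spectrum X \<Longrightarrow> cmod (poly p z) \<le> K"
  shows "norm (poly_op p X) \<le> K"
proof (cases "\<exists>v :: 'h. v \<noteq> 0")
  case False
  then have "poly_op p X = 0"
    by (intro blinfun_eqI) auto
  then show ?thesis
    using K by simp
next
  case True
  then obtain v :: 'h where v: "v \<noteq> 0" by blast
  define P P' where "P = poly_op p X" and "P' = poly_op (map_poly cnj p) X"
  have lin: "X \<in> clinear_ops"
    using X by (rule self_adjointD)
  have adj: "is_adjoint P P'"
    unfolding P_def P'_def by (rule is_adjoint_poly_op[OF X])
  have PP: "P' o\<^sub>L P = poly_op (map_poly cnj p * p) X"
    by (simp add: P_def P'_def poly_op_mult[OF lin])
  have "self_adjoint (P' o\<^sub>L P)"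
    using is_adjoint_compose[OF is_adjoint_sym[OF adj] adj]
    by (simp add: self_adjoint_def PP poly_op_clinear[OF lin])
  then obtain c where c: "c \<in> spectrum (P' o\<^sub>L P)" "cmod c = norm (P' o\<^sub>L P)"
    using self_adjoint_norm_in_spectrum[OF _ v] by blast
  have "spectrum X \<noteq> {}"
    using self_adjoint_norm_in_spectrum[OF X v] by auto
  then obtain z where z: "z \<in> spectrum X" "c = poly (map_poly cnj p * p) z"
    using spectrum_poly_op_subset[OF lin] c(1) unfolding PP by blast
  have "cnj z = z"
    using z(1) spectrum_self_adjoint_real[OF X] by (auto simp: Reals_cnj_iff)
  then have "c = cnj (poly p z) * poly p z"
    using poly_cnj[of p z] by (simp add: z(2))
  then have "cmod c = (cmod (poly p z))\<^sup>2"
    by (simp add: norm_mult power2_eq_square)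
  then have PPK: "norm (P' o\<^sub>L P) \<le> K\<^sup>2"
    using K(2)[OF z(1)] c(2) by (metis norm_ge_zero power_mono)
  show ?thesis
    unfolding P_def[symmetric]
  proof (rule norm_blinfun_bound[OF K(1)])
    fix x
    have "complex_of_real ((norm (P x))\<^sup>2) = cinner x ((P' o\<^sub>L P) x)"
      by (simp add: cinner_self flip: is_adjointD[OF adj])
    then have "(norm (P x))\<^sup>2 = cmod (cinner x ((P' o\<^sub>L P) x))"
      by (metis norm_of_real abs_power2 real_norm_def)
    also have "\<dots> \<le> norm x * norm ((P' o\<^sub>L P) x)"
      by (rule Cauchy_Schwarz_cinner)
    also have "\<dots> \<le> norm x * (norm (P' o\<^sub>L P) * norm x)"
      by (intro mult_left_mono norm_blinfun) simp
    also have "\<dots> \<le> norm x * (K\<^sup>2 * norm x)"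
      by (intro mult_left_mono mult_right_mono PPK) auto
    finally have "(norm (P x))\<^sup>2 \<le> (K * norm x)\<^sup>2"
      by (simp add: power2_eq_square mult_ac)
    then show "norm (P x) \<le> K * norm x"
      by (rule power2_le_imp_le) (simp add: K)
  qed
qed

section \<open>Continuous functional calculus of a self-adjoint operator\<close>

lemma poly_op_tendsto_0:
  assumes X: "self_adjoint X" and lim: "uniform_limit (spectrum X) (\<lambda>n. poly (p n)) (\<lambda>_. 0) sequentially"
  shows "(\<lambda>n. poly_op (p n) X) \<longlonglongrightarrow> 0"
proof (rule tendstoI)
  fix e :: real assume "e > 0"
  then have "\<forall>\<^sub>F n in sequentially. \<forall>z\<in>spectrum X. dist (poly (p n) z) 0 < e / 2"
    using uniform_limitD[OF lim, of "e / 2"] by simp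
  then show "\<forall>\<^sub>F n in sequentially. dist (poly_op (p n) X) 0 < e"
  proof eventually_elim
    case (elim n)
    then have "norm (poly_op (p n) X) \<le> e / 2"
      using \<open>e > 0\<close> by (intro norm_poly_op_le[OF X]) (auto intro: less_imp_le)
    then show ?case
      using \<open>e > 0\<close> by simp
  qed
qed

text \<open>The difference of two sequences of polynomials that approximate \<open>g\<close> tends to 0 uniformly on the
  spectrum, so its value at \<open>X\<close> tends to 0 as well.\<close>

lemma has_cfc_poly_op_limit:
  assumes X: "self_adjoint X" and "has_cfc g X Z"
    and lim: "uniform_limit (spectrum X) (\<lambda>n. poly (p n)) g sequentially"
  shows "(\<lambda>n. poly_op (p n) X) \<longlonglongrightarrow> Z"
proof -
  obtain q where q: "uniform_limit (spectrum X) (\<lambda>n. poly (q n)) g sequentially"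
    "(\<lambda>n. poly_op (q n) X) \<longlonglongrightarrow> Z"
    using assms(2) by (auto simp: has_cfc_def)
  have "uniform_limit (spectrum X) (\<lambda>n z. poly (p n) z - poly (q n) z) (\<lambda>z. g z - g z) sequentially"
    by (intro uniform_limit_intros lim q)
  then have "(\<lambda>n. poly_op (p n - q n) X) \<longlonglongrightarrow> 0"
    by (intro poly_op_tendsto_0[OF X]) (simp add: poly_diff uniform_limit_iff)
  from tendsto_add[OF this q(2)] show ?thesis
    by (simp add: poly_op_diff[OF self_adjointD(1)[OF X]])
qed

lemma has_cfc_unique:
  assumes X: "self_adjoint X" and "has_cfc g X Z" "has_cfc g X Z'"
  shows "Z = Z'"
proof -
  obtain p where "uniform_limit (spectrum X) (\<lambda>n. poly (p n)) g sequentially"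
      "(\<lambda>n. poly_op (p n) X) \<longlonglongrightarrow> Z"
    using assms(2) by (auto simp: has_cfc_def)
  then show ?thesis
    using has_cfc_poly_op_limit[OF X assms(3)] LIMSEQ_unique by blast
qed

lemma cfc_eqI:
  assumes "self_adjoint X" "has_cfc g X Z"
  shows "cfc g X = Z"
  unfolding cfc_def
  by (rule the_equality, rule assms(2)) (rule has_cfc_unique[OF assms(1) _ assms(2)])

lemma real_polynomial_function_imp_complex_poly:
  assumes "real_polynomial_function f"
  obtains p where "\<And>t. poly p (complex_of_real t) = complex_of_real (f t)"
proof -
  obtain a n where f: "f = (\<lambda>t. \<Sum>i\<le>n. a i * t ^ i)"
    using assms by (auto simp: real_polynomial_function_iff_sum)
  show thesis
    by (rule that[of "\<Sum>i\<le>n. monom (complex_of_real (a i)) i"])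
      (simp add: f poly_sum poly_monom)
qed

lemma complex_Weierstrass_uniform_limit:
  fixes h :: "real \<Rightarrow> complex"
  assumes "continuous_on {a..b} h"
  obtains p where "uniform_limit {a..b} (\<lambda>n t. poly (p n) (complex_of_real t)) h sequentially"
proof -
  obtain g where g: "uniform_limit {a..b} g h sequentially" "\<And>n. polynomial_function (g n)"
    using Stone_Weierstrass_uniform_limit[OF compact_Icc assms] by blast
  have "\<exists>p. \<forall>t. poly p (complex_of_real t) = g n t" for n
  proof -
    have "real_polynomial_function (Re \<circ> g n)" "real_polynomial_function (Im \<circ> g n)"
      using g(2)[of n] bounded_linear_Re bounded_linear_Im by (auto simp: polynomial_function_def)
    then obtain p q where "\<And>t. poly p (complex_of_real t) = complex_of_real ((Re \<circ> g n) t)"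
      "\<And>t. poly q (complex_of_real t) = complex_of_real ((Im \<circ> g n) t)"
      by (meson real_polynomial_function_imp_complex_poly)
    then have "poly (p + smult \<i> q) (complex_of_real t) = g n t" for t
      by (simp add: complex_eq_iff)
    then show ?thesis
      by blast
  qed
  then obtain p where "\<And>n t. poly (p n) (complex_of_real t) = g n t"
    by metis
  with g(1) show thesis
    by (intro that[of p]) simp
qed

text \<open>Polynomials that converge uniformly on the spectrum form a Cauchy sequence of operators by
  \<open>norm_poly_op_le\<close>.\<close>

lemma has_cfc_exists:
  assumes X: "self_adjoint X" and S: "spectrum X \<subseteq> complex_of_real ` {a..b}"
    and g: "continuous_on {a..b} (\<lambda>t. g (complex_of_real t))"
  shows "\<exists>Z. has_cfc g X Z"
proof -
  obtain p where p: "uniform_limit {a..b} (\<lambda>n t. poly (p n) (complex_of_real t)) (\<lambda>t. g (complex_of_real t)) sequentially"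
    using complex_Weierstrass_uniform_limit[OF g] .
  have lim: "uniform_limit (spectrum X) (\<lambda>n. poly (p n)) g sequentially"
  proof (rule uniform_limitI)
    fix e :: real assume "e > 0"
    with uniform_limitD[OF p] have
      "\<forall>\<^sub>F n in sequentially. \<forall>t\<in>{a..b}. dist (poly (p n) (complex_of_real t)) (g (complex_of_real t)) < e"
      by blast
    then show "\<forall>\<^sub>F n in sequentially. \<forall>z\<in>spectrum X. dist (poly (p n) z) (g z) < e"
      by eventually_elim (use S in blast)
  qed
  have "Cauchy (\<lambda>n. poly_op (p n) X)"
  proof (rule CauchyI)
    fix e :: real assume e: "e > 0"
    then have "e / 4 > 0" by simp
    from uniform_limitD[OF lim this] obtain N where
      N: "\<And>n z. n \<ge> N \<Longrightarrow> z \<in> spectrum X \<Longrightarrow> dist (poly (p n) z) (g z) < e / 4"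
      by (auto simp: eventually_sequentially)
    have "norm (poly_op (p m) X - poly_op (p n) X) < e" if "m \<ge> N" "n \<ge> N" for m n
    proof -
      have "cmod (poly (p m - p n) z) \<le> e / 2" if z: "z \<in> spectrum X" for z
        using N[OF \<open>m \<ge> N\<close> z] N[OF \<open>n \<ge> N\<close> z] dist_triangle2[of "poly (p m) z" "poly (p n) z" "g z"]
        by (simp add: dist_norm)
      then have "norm (poly_op (p m - p n) X) \<le> e / 2"
        using e by (intro norm_poly_op_le[OF X]) auto
      then show ?thesis
        using e by (simp add: poly_op_diff[OF self_adjointD(1)[OF X]])
    qed
    then show "\<exists>M. \<forall>m\<ge>M. \<forall>n\<ge>M. norm (poly_op (p m) X - poly_op (p n) X) < e"
      by blast
  qed
  then obtain Z where "(\<lambda>n. poly_op (p n) X) \<longlonglongrightarrow> Z"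
    by (auto simp: Cauchy_convergent_iff convergent_def)
  with lim show ?thesis
    by (auto simp: has_cfc_def)
qed

lemma has_cfc_clinear:
  assumes "X \<in> clinear_ops" "has_cfc g X Z"
  shows "Z \<in> clinear_ops"
proof -
  obtain p where "(\<lambda>n. poly_op (p n) X) \<longlonglongrightarrow> Z"
    using assms(2) by (auto simp: has_cfc_def)
  then show ?thesis
    using closed_sequentially[OF closed_clinear_ops, of "\<lambda>n. poly_op (p n) X"]
      poly_op_clinear[OF assms(1)] by blast
qed

lemma has_cfc_compose:
  assumes X: "X \<in> clinear_ops" and gh: "has_cfc g X Z" "has_cfc h X W"
    and bdd: "bounded (g ` spectrum X)" "bounded (h ` spectrum X)"
  shows "has_cfc (\<lambda>z. g z * h z) X (Z o\<^sub>L W)"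
proof -
  obtain p q where p: "uniform_limit (spectrum X) (\<lambda>n. poly (p n)) g sequentially"
      "(\<lambda>n. poly_op (p n) X) \<longlonglongrightarrow> Z"
    and q: "uniform_limit (spectrum X) (\<lambda>n. poly (q n)) h sequentially"
      "(\<lambda>n. poly_op (q n) X) \<longlonglongrightarrow> W"
    using gh by (auto simp: has_cfc_def)
  have "uniform_limit (spectrum X) (\<lambda>n. poly (p n * q n)) (\<lambda>z. g z * h z) sequentially"
    using uniform_lim_mult[OF p(1) q(1) bdd] by (simp add: uniform_limit_iff)
  moreover have "(\<lambda>n. poly_op (p n * q n) X) \<longlonglongrightarrow> (Z o\<^sub>L W)"
    using bounded_bilinear.tendsto[OF bounded_bilinear_blinfun_compose p(2) q(2)]
    by (simp add: poly_op_mult[OF X])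
  ultimately show ?thesis
    unfolding has_cfc_def by (intro exI[of _ "\<lambda>n. p n * q n"] conjI)
qed

lemma has_cfc_one: "X \<in> clinear_ops \<Longrightarrow> has_cfc (\<lambda>_. 1) X id_blinfun"
  unfolding has_cfc_def
  by (intro exI[of _ "\<lambda>_. 1"])
    (simp add: one_pCons poly_op_const scalar_op_one uniform_limit_iff)

lemma has_cfc_cong:
  assumes "\<And>z. z \<in> spectrum X \<Longrightarrow> g z = h z"
  shows "has_cfc g X Z \<longleftrightarrow> has_cfc h X Z"
  unfolding has_cfc_def uniform_limit_iff using assms by simp

text \<open>On a real spectrum the conjugate polynomials converge to the conjugate of \<open>g\<close>, which is \<open>g\<close>
  again, and they compute the adjoints.\<close>

lemma has_cfc_real_is_adjoint:
  assumes X: "self_adjoint X" and g: "has_cfc g X Z" "\<And>z. z \<in> spectrum X \<Longrightarrow> g z \<in> \<real>"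
  shows "is_adjoint Z Z"
proof -
  obtain p where p: "uniform_limit (spectrum X) (\<lambda>n. poly (p n)) g sequentially"
      "(\<lambda>n. poly_op (p n) X) \<longlonglongrightarrow> Z"
    using g(1) by (auto simp: has_cfc_def)
  have "poly (map_poly cnj (p n)) z = cnj (poly (p n) z)" if "z \<in> spectrum X" for n z
    using spectrum_self_adjoint_real[OF X] that poly_cnj[of "p n" z] by (auto simp: Reals_cnj_iff)
  then have "dist (poly (map_poly cnj (p n)) z) (g z) = dist (poly (p n) z) (g z)"
    if "z \<in> spectrum X" for n z
    using g(2)[OF that] that
    by (metis Reals_cnj_iff complex_cnj_diff complex_mod_cnj dist_norm)
  then have "uniform_limit (spectrum X) (\<lambda>n. poly (map_poly cnj (p n))) g sequentially"
    using p(1) by (simp add: uniform_limit_iff)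
  then have "(\<lambda>n. poly_op (map_poly cnj (p n)) X) \<longlonglongrightarrow> Z"
    by (rule has_cfc_poly_op_limit[OF X g(1)])
  then show ?thesis
    by (rule is_adjoint_limit[OF is_adjoint_poly_op[OF X] p(2)])
qed

lemma spectrum_scalar_op_compose:
  assumes "a \<noteq> 0" "w \<in> spectrum (scalar_op a o\<^sub>L X)"
  shows "w / a \<in> spectrum X"
proof (rule ccontr)
  assume "w / a \<notin> spectrum X"
  then have "invertible_op (scalar_op a o\<^sub>L (X - scalar_op (w / a)))"
    using assms(1) by (intro invertible_compose invertible_scalar_op) (auto simp: spectrum_def)
  moreover have "scalar_op a o\<^sub>L (X - scalar_op (w / a)) = (scalar_op a o\<^sub>L X) - scalar_op w"
    using assms(1) by (intro blinfun_eqI)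
      (simp add: blinfun.diff_left scaleC_diff_right scaleC_scaleC)
  ultimately show False
    using assms(2) by (simp add: spectrum_def)
qed

text \<open>If the polynomials \<open>p\<^sub>n\<close> compute \<open>g(X)\<close>, then the polynomials \<open>c p\<^sub>n(z / a)\<close> compute \<open>c g(X)\<close> from
  \<open>a X\<close>.\<close>

lemma has_cfc_scale:
  assumes X: "X \<in> clinear_ops" and a: "a \<noteq> 0" and g: "has_cfc g X Z"
    and h: "\<And>z. z \<in> spectrum X \<Longrightarrow> h (a * z) = c * g z"
  shows "has_cfc h (scalar_op a o\<^sub>L X) (scalar_op c o\<^sub>L Z)"
proof -
  let ?aX = "scalar_op a o\<^sub>L X"
  obtain p where p: "uniform_limit (spectrum X) (\<lambda>n. poly (p n)) g sequentially"
      "(\<lambda>n. poly_op (p n) X) \<longlonglongrightarrow> Z"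
    using g by (auto simp: has_cfc_def)
  have aX: "?aX \<in> clinear_ops"
    by (intro clinear_intros X)
  define q where "q n = smult c (pcompose (p n) [:0, 1 / a:])" for n
  have "poly_op [:0, 1 / a:] ?aX = ?aX o\<^sub>L scalar_op (1 / a)"
    by (simp add: poly_op_pCons[OF aX] scalar_op_zero)
  also have "\<dots> = X"
    using a by (intro blinfun_eqI) (simp add: clinear_opsD[OF X] scaleC_scaleC)
  finally have q_op: "poly_op (q n) ?aX = scalar_op c o\<^sub>L poly_op (p n) X" for n
    by (simp add: q_def poly_op_smult[OF aX] poly_op_pcompose[OF aX])
  have "uniform_limit (spectrum ?aX) (\<lambda>n w. c * poly (p n) (w / a)) (\<lambda>w. c * g (w / a)) sequentially"
    by (intro bounded_linear.uniform_limit[OF bounded_linear_mult_right]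
      uniform_limit_compose'[OF p(1)]) (use spectrum_scalar_op_compose[OF a] in auto)
  moreover have "poly (q n) w = c * poly (p n) (w / a)" for n w
    by (simp add: q_def poly_pcompose)
  moreover have "h w = c * g (w / a)" if "w \<in> spectrum ?aX" for w
    using h[OF spectrum_scalar_op_compose[OF a that]] a by simp
  ultimately have "uniform_limit (spectrum ?aX) (\<lambda>n. poly (q n)) h sequentially"
    by (simp add: uniform_limit_iff)
  moreover have "(\<lambda>n. poly_op (q n) ?aX) \<longlonglongrightarrow> (scalar_op c o\<^sub>L Z)"
    unfolding q_op by (intro bounded_bilinear.tendsto[OF bounded_bilinear_blinfun_compose]
      tendsto_const p(2))
  ultimately show ?thesis
    unfolding has_cfc_def by (intro exI[of _ q] conjI)
qed

section \<open>Powers of strictly positive operators\<close>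

lemma strictly_positive_has_cfc:
  assumes X: "strictly_positive X" and g: "continuous_on {0<..} (\<lambda>t. g (complex_of_real t))"
  shows "has_cfc g X (cfc g X)" and "bounded (g ` spectrum X)"
proof -
  obtain a b where ab: "a > 0" "spectrum X \<subseteq> complex_of_real ` {a..b}"
    using spectrum_strictly_positive[OF X] by blast
  have g': "continuous_on {a..b} (\<lambda>t. g (complex_of_real t))"
    using ab(1) by (intro continuous_on_subset[OF g]) auto
  then show "has_cfc g X (cfc g X)"
    using has_cfc_exists[OF strictly_positive_imp_self_adjoint[OF X] ab(2)]
      cfc_eqI[OF strictly_positive_imp_self_adjoint[OF X]] by blast
  have "g ` spectrum X \<subseteq> (\<lambda>t. g (complex_of_real t)) ` {a..b}"
    using ab(2) by auto
  then show "bounded (g ` spectrum X)"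
    using compact_continuous_image[OF g'] compact_imp_bounded bounded_subset by blast
qed

lemma strictly_positive_clinear: "strictly_positive X \<Longrightarrow> X \<in> clinear_ops"
  by (simp add: self_adjointD strictly_positive_imp_self_adjoint)

lemma strictly_positive_cfc_clinear:
  assumes "strictly_positive X" "continuous_on {0<..} (\<lambda>t. g (complex_of_real t))"
  shows "cfc g X \<in> clinear_ops"
  by (rule has_cfc_clinear[OF strictly_positive_clinear[OF assms(1)]
    strictly_positive_has_cfc(1)[OF assms]])

lemma continuous_on_powr_positive:
  "continuous_on {0<..} (\<lambda>t. complex_of_real t powr complex_of_real r)"
proof -
  have "continuous_on {0<..} (\<lambda>t. complex_of_real (t powr r))"
    by (intro continuous_intros) auto
  then show ?thesis
    by (rule continuous_on_eq) (simp add: powr_of_real)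
qed

lemma spectrum_strictly_positive_cases:
  assumes "strictly_positive X" "z \<in> spectrum X"
  obtains t where "t > 0" "z = complex_of_real t"
proof -
  obtain a b where "a > 0" "spectrum X \<subseteq> complex_of_real ` {a..b}"
    using spectrum_strictly_positive[OF assms(1)] .
  with assms(2) show thesis
    using that by fastforce
qed

lemmas has_cfc_op_power =
  strictly_positive_has_cfc[OF _ continuous_on_powr_positive, folded op_power_def]

lemma op_power_clinear: "strictly_positive X \<Longrightarrow> op_power X r \<in> clinear_ops"
  unfolding op_power_def by (rule strictly_positive_cfc_clinear[OF _ continuous_on_powr_positive])

lemma op_power_is_adjoint:
  assumes X: "strictly_positive X"
  shows "is_adjoint (op_power X r) (op_power X r)"
proof (rule has_cfc_real_is_adjoint[OF strictly_positive_imp_self_adjoint[OF X] has_cfc_op_power(1)[OF X]])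
  fix z assume "z \<in> spectrum X"
  then obtain t where "t > 0" "z = complex_of_real t"
    using spectrum_strictly_positive_cases[OF X] by blast
  then show "z powr complex_of_real r \<in> \<real>"
    by (simp add: powr_of_real)
qed

lemma op_power_compose_inverse:
  assumes X: "strictly_positive X"
  shows "op_power X r o\<^sub>L op_power X (- r) = id_blinfun"
proof -
  have "has_cfc (\<lambda>z. z powr complex_of_real r * z powr complex_of_real (- r)) X
      (op_power X r o\<^sub>L op_power X (- r))"
    by (intro has_cfc_compose strictly_positive_clinear has_cfc_op_power X)
  moreover have "z powr complex_of_real r * z powr complex_of_real (- r) = 1"
    if z: "z \<in> spectrum X" for z
  proof -
    obtain t where "t > 0" "z = complex_of_real t"
      using spectrum_strictly_positive_cases[OF X z] .
    then show ?thesis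
      by (simp add: powr_minus)
  qed
  ultimately have "has_cfc (\<lambda>_. 1) X (op_power X r o\<^sub>L op_power X (- r))"
    using has_cfc_cong[of X "\<lambda>z. z powr complex_of_real r * z powr complex_of_real (- r)" "\<lambda>_. 1"]
    by simp
  then show ?thesis
    using has_cfc_unique[OF strictly_positive_imp_self_adjoint[OF X]]
      has_cfc_one[OF strictly_positive_clinear[OF X]] by blast
qed

text \<open>For negative \<open>a\<close> the factor is not real: \<open>a\<close> to the power \<open>1/2\<close> is \<open>\<i> \<surd>\<bar>a\<bar>\<close>.  The rule
  \<open>(a t)\<^sup>r = a\<^sup>r t\<^sup>r\<close> survives on the principal branch since \<open>t > 0\<close> does not change the argument.\<close>

lemma op_power_scaleR:
  assumes X: "strictly_positive X" and a: "a \<noteq> 0"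
  shows "op_power (a *\<^sub>R X) r
    = scalar_op (complex_of_real a powr complex_of_real r) o\<^sub>L op_power X r"
proof -
  have "self_adjoint X"
    using X by (rule strictly_positive_imp_self_adjoint)
  then have "self_adjoint (scalar_op (complex_of_real a) o\<^sub>L X)"
    using is_adjoint_compose[OF is_adjoint_scalar_op[of "complex_of_real a"], of X X]
    by (simp add: self_adjoint_def scalar_op_commute clinear_intros)
  moreover have "has_cfc (\<lambda>z. z powr complex_of_real r) (scalar_op (complex_of_real a) o\<^sub>L X)
      (scalar_op (complex_of_real a powr complex_of_real r) o\<^sub>L op_power X r)"
  proof (rule has_cfc_scale[OF strictly_positive_clinear[OF X] _ has_cfc_op_power(1)[OF X]])
    fix z assume "z \<in> spectrum X"
    then obtain t where t: "t > 0" "z = complex_of_real t"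
      using spectrum_strictly_positive_cases[OF X] by blast
    show "(complex_of_real a * z) powr complex_of_real r
        = complex_of_real a powr complex_of_real r * z powr complex_of_real r"
      using powr_times_real_left[of z "complex_of_real a"] t by (simp add: mult.commute)
  qed (use a in simp)
  ultimately show ?thesis
    unfolding scaleR_eq_scalar_op by (subst op_power_def) (rule cfc_eqI)
qed

section \<open>Homogeneity of the relative operator entropy\<close>

lemma strictly_positive_congruence:
  assumes Y: "strictly_positive Y" and Z: "Z \<in> clinear_ops" "is_adjoint Z Z" "invertible_op Z"
  shows "strictly_positive (Z o\<^sub>L Y o\<^sub>L Z)"
  unfolding strictly_positive_def positive_op_def
proof (intro conjI allI)
  show "Z o\<^sub>L Y o\<^sub>L Z \<in> clinear_ops"
    by (intro clinear_intros Z strictly_positive_clinear Y)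
  show "cinner x ((Z o\<^sub>L Y o\<^sub>L Z) x) \<in> \<real>\<^sub>\<ge>\<^sub>0" for x
    using Y by (simp add: strictly_positive_def positive_op_def flip: is_adjointD[OF Z(2)])
  show "invertible_op (Z o\<^sub>L Y o\<^sub>L Z)"
    using Y by (intro invertible_compose Z) (simp_all add: strictly_positive_def)
qed

text \<open>\<open>c\<close> and \<open>d\<close> in the proof are the scalars that \<open>(a X)\<^bsup>1/2\<^esup>\<close> and \<open>(a X)\<^bsup>-1/2\<^esup>\<close>
  produce.  That \<open>M\<close> is
  strictly positive makes \<open>M\<^sup>q\<close> and \<open>f(M)\<close> complex linear, so that \<open>c\<close> can be moved past them.\<close>

lemma rel_entropy_scaleR:
  fixes X Y :: "'h::chilbert_space \<Rightarrow>\<^sub>L 'h"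
  assumes f: "continuous_on {0<..} f"
    and X: "strictly_positive X" and Y: "strictly_positive Y" and a: "a \<noteq> 0"
  shows "rel_entropy f q (a *\<^sub>R X) (a *\<^sub>R Y) = a *\<^sub>R rel_entropy f q X Y"
proof -
  let ?a = "complex_of_real a"
  define P R where "P = op_power X (1/2)" and "R = op_power X (-1/2)"
  define M where "M = R o\<^sub>L Y o\<^sub>L R"
  define c d where "c = ?a powr complex_of_real (1/2)" and "d = ?a powr complex_of_real (-1/2)"
  have pow_scaled: "op_power (a *\<^sub>R X) (1/2) = scalar_op c o\<^sub>L P"
      "op_power (a *\<^sub>R X) (-1/2) = scalar_op d o\<^sub>L R"
    unfolding P_def R_def c_def d_def by (rule op_power_scaleR[OF X a])+
  have cc: "c * c = ?a"
    using a by (simp add: c_def flip: powr_add)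
  have "c * d = 1"
    using a by (simp add: c_def d_def flip: powr_add)
  moreover have "d * ?a * d = (c * d) * (c * d)"
    by (simp add: mult_ac flip: cc)
  ultimately have dd: "d * ?a * d = 1"
    by simp
  have lin: "P \<in> clinear_ops" "R \<in> clinear_ops"
    unfolding P_def R_def by (intro op_power_clinear X)+
  have "invertible_op R"
    unfolding invertible_op_def R_def
    using op_power_compose_inverse[OF X, of "1/2"] op_power_compose_inverse[OF X, of "-1/2"] lin(1)
    by (intro bexI[of _ P]) (simp_all add: P_def)
  then have M: "strictly_positive M"
    unfolding M_def using op_power_is_adjoint[OF X] lin(2) Y
    by (intro strictly_positive_congruence) (simp_all add: R_def)
  have "continuous_on {0<..} (\<lambda>t. complex_of_real (f (Re (complex_of_real t))))"
    using f by (intro continuous_on_of_real) simp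
  then have lin_M: "op_power M q \<in> clinear_ops" "real_cfc f M \<in> clinear_ops"
    unfolding real_cfc_def by (intro op_power_clinear strictly_positive_cfc_clinear M | assumption)+
  have "(scalar_op d o\<^sub>L R) o\<^sub>L (a *\<^sub>R Y) o\<^sub>L (scalar_op d o\<^sub>L R) = scalar_op (d * ?a * d) o\<^sub>L M"
    by (intro blinfun_eqI) (simp add: M_def scaleR_eq_scalar_op scaleC_scaleC mult_ac
      clinear_opsD[OF lin(2)] clinear_opsD[OF strictly_positive_clinear[OF Y]])
  then have M_scaled: "(scalar_op d o\<^sub>L R) o\<^sub>L (a *\<^sub>R Y) o\<^sub>L (scalar_op d o\<^sub>L R) = M"
    unfolding dd scalar_op_one id_compose .
  have "rel_entropy f q (a *\<^sub>R X) (a *\<^sub>R Y)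
      = (scalar_op c o\<^sub>L P) o\<^sub>L op_power M q o\<^sub>L real_cfc f M o\<^sub>L (scalar_op c o\<^sub>L P)"
    unfolding rel_entropy_def pow_scaled M_scaled Let_def ..
  also have "\<dots> = scalar_op (c * c) o\<^sub>L (P o\<^sub>L op_power M q o\<^sub>L real_cfc f M o\<^sub>L P)"
    by (intro blinfun_eqI) (simp add: scaleC_scaleC clinear_opsD[OF lin(1)]
      clinear_opsD[OF lin_M(1)] clinear_opsD[OF lin_M(2)])
  also have "\<dots> = a *\<^sub>R rel_entropy f q X Y"
    unfolding cc rel_entropy_def Let_def scaleR_eq_scalar_op M_def P_def R_def ..
  finally show ?thesis .
qed

section \<open>Homogeneity of the integral of a field\<close>

text \<open>The vector functionals \<open>X \<mapsto> \<langle>y, X x\<rangle>\<close> belong to the dual and separate the operators.\<close>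

lemma has_field_integral_unique:
  fixes \<A> :: "('h::chilbert_space \<Rightarrow>\<^sub>L 'h) set"
  assumes "\<A> \<subseteq> clinear_ops" "has_field_integral \<A> \<mu> F I" "has_field_integral \<A> \<mu> F I'"
  shows "I = I'"
proof (rule blinfun_eqI, rule cinner_eqI)
  fix x y
  have "cmod (cinner y (X x)) \<le> (norm y * norm x) * norm X" for X :: "'h \<Rightarrow>\<^sub>L 'h"
  proof -
    have "cmod (cinner y (X x)) \<le> norm y * norm (X x)"
      by (rule Cauchy_Schwarz_cinner)
    also have "\<dots> \<le> norm y * (norm X * norm x)"
      by (intro mult_left_mono norm_blinfun) simp
    finally show ?thesis
      by (simp add: mult_ac)
  qed
  then have "(\<lambda>X. cinner y (blinfun_apply X x)) \<in> norm_dual \<A>"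
    unfolding norm_dual_def
    by (auto simp: blinfun.add_left cinner_add_right cinner_scaleC_right)
  then show "cinner y (I x) = cinner y (I' x)"
    using assms(2,3) by (auto simp: has_field_integral_def)
qed

lemma has_field_integral_scaleR:
  assumes \<A>: "\<And>c X. X \<in> \<A> \<Longrightarrow> scalar_op c o\<^sub>L X \<in> \<A>" and F: "has_field_integral \<A> \<mu> F I"
  shows "has_field_integral \<A> \<mu> (\<lambda>t. a *\<^sub>R F t) (a *\<^sub>R I)"
proof -
  have cont: "range F \<subseteq> \<A>" "continuous_on UNIV F" "integrable \<mu> (\<lambda>t. norm (F t))" and "I \<in> \<A>"
    and int: "\<And>\<phi>. \<phi> \<in> norm_dual \<A> \<Longrightarrow> \<phi> I = (LINT t|\<mu>. \<phi> (F t))"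
    using F by (auto simp: has_field_integral_def continuous_field_def)
  have "\<phi> (a *\<^sub>R I) = (LINT t|\<mu>. \<phi> (a *\<^sub>R F t))" if \<phi>: "\<phi> \<in> norm_dual \<A>" for \<phi>
  proof -
    have "\<phi> (a *\<^sub>R X) = complex_of_real a * \<phi> X" if "X \<in> \<A>" for X
      using \<phi> that by (simp add: norm_dual_def scaleR_eq_scalar_op)
    then show ?thesis
      using cont(1) \<open>I \<in> \<A>\<close> by (simp add: int[OF \<phi>] image_subset_iff)
  qed
  moreover have "a *\<^sub>R X \<in> \<A>" if "X \<in> \<A>" for X
    unfolding scaleR_eq_scalar_op using that by (rule \<A>)
  moreover have "continuous_on UNIV (\<lambda>t. a *\<^sub>R F t)"
    by (intro continuous_intros cont)
  ultimately show ?thesis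
    unfolding has_field_integral_def continuous_field_def
    using cont \<open>I \<in> \<A>\<close> by auto
qed

lemma field_integral_eqI:
  assumes "\<A> \<subseteq> clinear_ops" "has_field_integral \<A> \<mu> F I"
  shows "field_integral \<A> \<mu> F = I"
proof -
  have "(THE I. has_field_integral \<A> \<mu> F I) = I"
    by (rule the_equality, rule assms(2)) (rule has_field_integral_unique[OF assms(1) _ assms(2)])
  then show ?thesis
    using assms(2) by (auto simp: field_integral_def)
qed

text \<open>If the integral of \<open>F\<close> does not exist, then neither does that of \<open>a F\<close>, because \<open>F\<close> is a multiple
  of \<open>a F\<close>; both values are then the default 0.\<close>

lemma field_integral_scaleR:
  assumes sub: "\<A> \<subseteq> clinear_ops" and closed: "\<And>c X. X \<in> \<A> \<Longrightarrow> scalar_op c o\<^sub>L X \<in> \<A>" and a: "a \<noteq> 0"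
  shows "field_integral \<A> \<mu> (\<lambda>t. a *\<^sub>R F t) = a *\<^sub>R field_integral \<A> \<mu> F"
proof (cases "\<exists>I. has_field_integral \<A> \<mu> F I")
  case True
  then obtain I where I: "has_field_integral \<A> \<mu> F I"
    by blast
  show ?thesis
    unfolding field_integral_eqI[OF sub I]
    by (intro field_integral_eqI sub has_field_integral_scaleR closed I)
next
  case False
  have "\<not> has_field_integral \<A> \<mu> (\<lambda>t. a *\<^sub>R F t) I" for I
  proof
    assume "has_field_integral \<A> \<mu> (\<lambda>t. a *\<^sub>R F t) I"
    from has_field_integral_scaleR[OF closed this, of "1 / a"] show False
      using False a by simp
  qed
  then show ?thesis
    using False by (simp add: field_integral_def)
qed

theorem lemma2p9:
  fixes \<A> :: "('h::chilbert_space \<Rightarrow>\<^sub>L 'h) set"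
    and \<mu> :: "'t::t2_space measure"
    and f :: "real \<Rightarrow> real"
    and q \<alpha> :: real
    and A B :: "'t \<Rightarrow> 'h \<Rightarrow>\<^sub>L 'h"
  assumes "cstar_algebra \<A>"
    and "locally_compact_space (euclidean :: 't topology)"
    and "radon_measure \<mu>"
    and "operator_monotone_on TYPE('h) {0<..} f"
    and "\<And>x. x > 0 \<Longrightarrow> f x \<ge> 0"
    and "continuous_field \<A> \<mu> A"
    and "\<And>s. strictly_positive (A s)"
    and "continuous_field \<A> \<mu> B"
    and "\<And>s. strictly_positive (B s)"
    and "\<alpha> \<noteq> 0"
  shows "gen_rel_entropy \<A> \<mu> f q (\<lambda>s. \<alpha> *\<^sub>R A s) (\<lambda>s. \<alpha> *\<^sub>R B s) =
    \<alpha> *\<^sub>R gen_rel_entropy \<A> \<mu> f q A B"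
proof -
  have "continuous_on {0<..} f"
    using assms(4) by (simp add: operator_monotone_on_def)
  then have "rel_entropy f q (\<alpha> *\<^sub>R A s) (\<alpha> *\<^sub>R B s) = \<alpha> *\<^sub>R rel_entropy f q (A s) (B s)" for s
    by (intro rel_entropy_scaleR assms(7,9,10))
  then show ?thesis
    unfolding gen_rel_entropy_def
    using assms(1,10) by (simp add: field_integral_scaleR cstar_algebra_def)
qed

end
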